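(* Let $n\ge 1$ be an integer. If $G$ is a connected graph of order $2n$ with a unique perfect matching, then $\rho(G)\leq\rho(G(2n,1))$, with equality if and only if $G\cong G(2n,1)$.
   Context: All graphs are finite, simple and undirected. The order of a graph is its number of vertices. For a graph $G$ with adjacency matrix $A(G)$, the spectral radius $\rho(G)$ is the largest eigenvalue of $A(G)$. The graph $G(2n,1)$ has order $2n$ and is defined as follows. Its vertex set is the disjoint union of $U=\{u_1,\ldots,u_n\}$ and $W=\{w_1,\ldots,w_n\}$; no two vertices of $U$ are adjacent, any two distinct vertices of $W$ are adjacent, and for each $1\leq i\leq n$ the set of neighbours of $u_i$ is exactly $\{w_1,w_2,\ldots,w_i\}$. *)

theory Defs
  imports
    "Graph_Theory.Graph_Theory"
    "Jordan_Normal_Form.Spectral_Radius"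
begin

text \<open>
  A finite simple undirected graph is a \<open>pair_graph\<close>: a finite vertex set together with a finite
  symmetric irreflexive set of arcs, the edge \<open>{u,v}\<close> being the pair of arcs \<open>(u,v)\<close>, \<open>(v,u)\<close>.
\<close>

definition edge_set :: "'a pair_pre_digraph \<Rightarrow> 'a set set" where
  "edge_set G = {{u, v} | u v. (u, v) \<in> parcs G}"

definition perfect_matching :: "'a pair_pre_digraph \<Rightarrow> 'a set set \<Rightarrow> bool" where
  "perfect_matching G M \<longleftrightarrow> M \<subseteq> edge_set G \<and> pairwise disjnt M \<and> \<Union>M = pverts G"

definition adjacency_matrix_of :: "'a pair_pre_digraph \<Rightarrow> 'a list \<Rightarrow> real mat" where
  "adjacency_matrix_of G xs =
     mat (length xs) (length xs) (\<lambda>(i, j). if (xs ! i, xs ! j) \<in> parcs G then 1 else 0)"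

text \<open>
  A matrix needs an ordering of the vertices; an arbitrary one is chosen. By
  \<open>spectrum_adjacency_matrix\<close> below, the spectrum does not depend on this choice.
\<close>

definition adjacency_matrix :: "'a pair_pre_digraph \<Rightarrow> real mat" where
  "adjacency_matrix G = adjacency_matrix_of G (SOME xs. distinct xs \<and> set xs = pverts G)"

definition graph_spectral_radius :: "'a pair_pre_digraph \<Rightarrow> real" where
  "graph_spectral_radius G = Max (spectrum (adjacency_matrix G))"

text \<open>The graph $G(2n,1)$; \<open>Inl i\<close> stands for $u_i$ and \<open>Inr i\<close> for $w_i$.\<close>

definition G2n1 :: "nat \<Rightarrow> (nat + nat) pair_pre_digraph" where
  "G2n1 n = \<lparr>
     pverts = Inl ` {1..n} \<union> Inr ` {1..n},
     parcs = {(Inr i, Inr j) | i j. i \<in> {1..n} \<and> j \<in> {1..n} \<and> i \<noteq> j}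
       \<union> {(Inl i, Inr j) | i j. i \<in> {1..n} \<and> j \<in> {1..i}}
       \<union> {(Inr j, Inl i) | i j. i \<in> {1..n} \<and> j \<in> {1..i}}\<rparr>"

lemma pair_graph_G2n1: "pair_graph (G2n1 n)"
proof unfold_locales
  have "parcs (G2n1 n) \<subseteq> pverts (G2n1 n) \<times> pverts (G2n1 n)"
    by (auto simp: G2n1_def)
  moreover show "finite (pverts (G2n1 n))"
    by (simp add: G2n1_def)
  ultimately show "finite (parcs (G2n1 n))"
    by (meson finite_SigmaI finite_subset)
  show "symmetric (with_proj (G2n1 n))"
    unfolding symmetric_def by (auto simp: G2n1_def intro!: symI)
qed (auto simp: G2n1_def)

lemma card_pverts_G2n1: "card (pverts (G2n1 n)) = 2 * n"
  by (subst G2n1_def, simp, subst card_Un_disjoint) (auto simp: card_image)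

lemma eigenvalue_adjacency_matrix_of:
  assumes "distinct xs"
  shows "eigenvalue (adjacency_matrix_of G xs) k \<longleftrightarrow>
    (\<exists>f. (\<exists>u\<in>set xs. f u \<noteq> 0) \<and>
      (\<forall>u\<in>set xs. (\<Sum>v\<in>set xs. if (u, v) \<in> parcs G then f v else 0) = k * f u))"
    (is "?L \<longleftrightarrow> ?R")
proof -
  let ?n = "length xs" and ?A = "adjacency_matrix_of G xs"
  have bij: "bij_betw ((!) xs) {..<?n} (set xs)"
    by (rule bij_betw_nth[OF assms]) auto
  have row: "(?A *\<^sub>v v) $ i = (\<Sum>w\<in>set xs. if (xs ! i, w) \<in> parcs G then f w else 0)"
    if "i < ?n" "v \<in> carrier_vec ?n" "\<And>j. j < ?n \<Longrightarrow> v $ j = f (xs ! j)" for v i f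
  proof -
    have "(?A *\<^sub>v v) $ i = (\<Sum>j<?n. if (xs ! i, xs ! j) \<in> parcs G then f (xs ! j) else 0)"
      using that
      by (auto simp: adjacency_matrix_of_def scalar_prod_def atLeast0LessThan intro!: sum.cong)
    also have "\<dots> = (\<Sum>w\<in>set xs. if (xs ! i, w) \<in> parcs G then f w else 0)"
      by (rule sum.reindex_bij_betw[OF bij])
    finally show ?thesis .
  qed
  show ?thesis
  proof
    assume ?L
    then obtain v where v: "v \<in> carrier_vec ?n" "v \<noteq> 0\<^sub>v ?n" "?A *\<^sub>v v = k \<cdot>\<^sub>v v"
      by (auto simp: eigenvalue_def eigenvector_def adjacency_matrix_of_def)
    define f where "f w = v $ the_inv_into {..<?n} ((!) xs) w" for w
    have f: "f (xs ! j) = v $ j" if "j < ?n" for j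
      using that bij by (simp add: f_def the_inv_into_f_f bij_betw_def)
    have "\<exists>i<?n. v $ i \<noteq> 0"
      using v(1,2) by (metis carrier_vecD eq_vecI index_zero_vec)
    then have "\<exists>u\<in>set xs. f u \<noteq> 0"
      using f by (metis nth_mem)
    moreover have "(\<Sum>w\<in>set xs. if (u, w) \<in> parcs G then f w else 0) = k * f u"
      if u: "u \<in> set xs" for u
    proof -
      obtain i where i: "i < ?n" "u = xs ! i"
        using u by (auto simp: in_set_conv_nth)
      show ?thesis
        using row[OF i(1) v(1), of f] f v i by simp
    qed
    ultimately show ?R
      by blast
  next
    assume ?R
    then obtain f where f: "\<exists>u\<in>set xs. f u \<noteq> 0"
      "\<And>u. u \<in> set xs \<Longrightarrow> (\<Sum>v\<in>set xs. if (u, v) \<in> parcs G then f v else 0) = k * f u"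
      by blast
    define v where "v = vec ?n (\<lambda>i. f (xs ! i))"
    obtain i where "i < ?n" "f (xs ! i) \<noteq> 0"
      using f(1) by (auto simp: in_set_conv_nth)
    then have "v $ i \<noteq> 0\<^sub>v ?n $ i"
      by (simp add: v_def)
    then have "v \<noteq> 0\<^sub>v ?n"
      by auto
    moreover have "?A *\<^sub>v v = k \<cdot>\<^sub>v v"
    proof (rule eq_vecI)
      fix i assume "i < dim_vec (k \<cdot>\<^sub>v v)"
      then have i: "i < ?n"
        by (simp add: v_def)
      show "(?A *\<^sub>v v) $ i = (k \<cdot>\<^sub>v v) $ i"
        using row[OF i, of v f] f(2)[of "xs ! i"] i by (simp add: v_def)
    qed (simp add: v_def adjacency_matrix_of_def)
    ultimately show ?L
      unfolding eigenvalue_def eigenvector_def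
      by (intro exI[of _ v]) (simp add: v_def adjacency_matrix_of_def)
  qed
qed

lemma spectrum_adjacency_matrix:
  assumes "distinct xs" "set xs = pverts G"
  shows "spectrum (adjacency_matrix G) = spectrum (adjacency_matrix_of G xs)"
proof -
  define ys where "ys = (SOME ys. distinct ys \<and> set ys = pverts G)"
  have "distinct ys \<and> set ys = pverts G"
    unfolding ys_def by (rule someI[of _ xs]) (use assms in simp)
  with assms have "eigenvalue (adjacency_matrix_of G ys) k = eigenvalue (adjacency_matrix_of G xs) k"
    for k
    by (simp only: eigenvalue_adjacency_matrix_of)
  then show ?thesis
    by (auto simp: spectrum_def adjacency_matrix_def simp flip: ys_def)
qed

end

theory Submission
  imports Defs "HOL-Analysis.Function_Topology"
begin

text \<open>
  Let \<open>f \<ge> 0\<close> be a maximal eigenvector of \<open>A(G)\<close>. Label the edges of the perfect matching as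
  \<open>u\<^sub>i w\<^sub>i\<close> with \<open>f(u\<^sub>i) \<le> f(w\<^sub>i)\<close>, in increasing order of \<open>f(u\<^sub>i) / f(w\<^sub>i)\<close>. As the matching is unique,
  there is no alternating 4-cycle: for \<open>i < j\<close> at most one of \<open>u\<^sub>i u\<^sub>j\<close>, \<open>w\<^sub>i w\<^sub>j\<close> and at most one of
  \<open>u\<^sub>i w\<^sub>j\<close>, \<open>w\<^sub>i u\<^sub>j\<close> is an edge. By the choice of the labelling the edges \<open>w\<^sub>i w\<^sub>j\<close> and \<open>w\<^sub>i u\<^sub>j\<close>, which
  are those of \<open>G(2n,1)\<close>, contribute most to the quadratic form of \<open>A(G)\<close> at \<open>f\<close>, so the bound
  follows from Rayleigh's principle. In case of equality \<open>f\<close> is an eigenvector of \<open>G(2n,1)\<close>, which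
  makes all the comparisons strict and determines the edges of \<open>G\<close>.
\<close>

section \<open>Rayleigh quotients\<close>

text \<open>The quadratic form of the adjacency matrix, summed over vertices rather than list
  positions so that no ordering of the vertices enters. Each edge counts twice, once per
  arc.\<close>

definition adjacency_form :: "'a pair_pre_digraph \<Rightarrow> ('a \<Rightarrow> real) \<Rightarrow> real" where
  "adjacency_form G f =
     (\<Sum>u\<in>pverts G. \<Sum>v\<in>pverts G. if (u, v) \<in> parcs G then f u * f v else 0)"

text \<open>Forcing \<open>f\<close> to vanish off \<open>V\<close> places the set inside a product
  of copies of [-1,1] and {0}, compact by Tychonoff even if the type \<open>'a\<close> is infinite.
  The norm condition is closed there.\<close>

lemma compact_unit_sphere_on:
  assumes fin: "finite V"
  shows "compact {f :: 'a \<Rightarrow> real. (\<forall>v. v \<notin> V \<longrightarrow> f v = 0) \<and> (\<Sum>v\<in>V. (f v)\<^sup>2) = 1}"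
proof -
  let ?S = "\<lambda>v. if v \<in> V then {-1..1} else {0::real}"
  have "compactin (product_topology (\<lambda>_. euclidean) UNIV) (PiE UNIV ?S)"
    by (subst compactin_PiE) auto
  then have box: "compact (PiE UNIV ?S)"
    by (simp add: euclidean_product_topology)
  have "closed {f :: 'a \<Rightarrow> real. (\<Sum>v\<in>V. (f v)\<^sup>2) = 1}"
    by (intro closed_Collect_eq continuous_intros continuous_on_product_coordinates)
  from compact_Int_closed[OF box this]
  have "compact (PiE UNIV ?S \<inter> {f. (\<Sum>v\<in>V. (f v)\<^sup>2) = 1})" .
  also have "PiE UNIV ?S \<inter> {f. (\<Sum>v\<in>V. (f v)\<^sup>2) = 1} =
    {f. (\<forall>v. v \<notin> V \<longrightarrow> f v = 0) \<and> (\<Sum>v\<in>V. (f v)\<^sup>2) = 1}" (is "?L = ?R")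
  proof
    show "?L \<subseteq> ?R"
      by (auto simp: PiE_iff split: if_splits)
    show "?R \<subseteq> ?L"
    proof
      fix f assume f: "f \<in> ?R"
      have "\<bar>f v\<bar> \<le> 1" if "v \<in> V" for v
      proof -
        have "(f v)\<^sup>2 \<le> (\<Sum>v\<in>V. (f v)\<^sup>2)"
          by (rule member_le_sum) (use that fin in auto)
        with f show ?thesis
          by (simp add: abs_square_le_1)
      qed
      with f show "f \<in> ?L"
        by (force simp: PiE_iff abs_le_iff)
    qed
  qed
  finally show ?thesis .
qed

text \<open>The continuous form attains its maximum on the compact unit sphere; homogeneity of
  degree two carries the bound over to every \<open>g\<close>.\<close>

lemma adjacency_form_maximum:
  assumes fin: "finite (pverts G)" and ne: "pverts G \<noteq> {}"
  obtains f where "(\<Sum>v\<in>pverts G. (f v)\<^sup>2) = 1"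
    "\<And>g. adjacency_form G g \<le> adjacency_form G f * (\<Sum>v\<in>pverts G. (g v)\<^sup>2)"
proof -
  let ?V = "pverts G"
  define K where "K = {f :: 'a \<Rightarrow> real. (\<forall>v. v \<notin> ?V \<longrightarrow> f v = 0) \<and> (\<Sum>v\<in>?V. (f v)\<^sup>2) = 1}"
  obtain w where w: "w \<in> ?V"
    using ne by blast
  have "(\<Sum>v\<in>?V. (if v = w then 1 else 0 :: real)\<^sup>2) = (\<Sum>v\<in>?V. if v = w then 1 else 0)"
    by (intro sum.cong) simp_all
  with w fin have "(\<lambda>v. if v = w then 1 else 0) \<in> K"
    by (simp add: K_def)
  then have "K \<noteq> {}"
    by blast
  moreover have "continuous_on K (adjacency_form G)"
  proof -
    have "continuous_on K (\<lambda>f. if (u, v) \<in> parcs G then f u * f v else 0)" for u v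
      by (cases "(u, v) \<in> parcs G") (auto intro!: continuous_intros
          continuous_on_subset[OF continuous_on_product_coordinates])
    then have "continuous_on K
        (\<lambda>f. \<Sum>u\<in>?V. \<Sum>v\<in>?V. if (u, v) \<in> parcs G then f u * f v else 0)"
      by (intro continuous_on_sum)
    then show ?thesis
      by (simp add: adjacency_form_def[abs_def])
  qed
  ultimately obtain f where f: "f \<in> K" "\<And>g. g \<in> K \<Longrightarrow> adjacency_form G g \<le> adjacency_form G f"
    using continuous_attains_sup[OF compact_unit_sphere_on[OF fin, folded K_def]] by blast
  have "adjacency_form G g \<le> adjacency_form G f * (\<Sum>v\<in>?V. (g v)\<^sup>2)" for g
  proof (cases "(\<Sum>v\<in>?V. (g v)\<^sup>2) = 0")
    case True
    then have "\<And>v. v \<in> ?V \<Longrightarrow> g v = 0"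
      using fin by (simp add: sum_nonneg_eq_0_iff)
    then have "adjacency_form G g = 0"
      unfolding adjacency_form_def by (intro sum.neutral ballI) auto
    with True show ?thesis
      by simp
  next
    case False
    define s where "s = (\<Sum>v\<in>?V. (g v)\<^sup>2)"
    have s: "s > 0"
      using False sum_nonneg[of ?V "\<lambda>v. (g v)\<^sup>2"] by (simp add: s_def less_le)
    \<comment> \<open>Only the values on the vertices matter for the form, so \<open>g\<close> is
      normalised there and cut off elsewhere to lie in \<open>K\<close>.\<close>
    define g' where "g' v = (if v \<in> ?V then g v / sqrt s else 0)" for v
    have "(\<Sum>v\<in>?V. (g' v)\<^sup>2) = (\<Sum>v\<in>?V. (g v)\<^sup>2 / s)"
      using s by (intro sum.cong) (auto simp: g'_def power_divide)
    also have "\<dots> = 1"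
      using s by (simp add: s_def flip: sum_divide_distrib)
    finally have "g' \<in> K"
      by (simp add: K_def g'_def)
    from f(2)[OF this] have "adjacency_form G g' \<le> adjacency_form G f" .
    moreover have "adjacency_form G g' = adjacency_form G g / s"
      unfolding adjacency_form_def sum_divide_distrib
      using s by (intro sum.cong) (auto simp: g'_def)
    ultimately show ?thesis
      using s by (simp add: s_def divide_le_eq)
  qed
  with f(1) show ?thesis
    by (intro that[of f]) (auto simp: K_def)
qed

context pair_graph
begin

text \<open>Second-order expansion along the line \<open>f + t g\<close>. The two cross terms agree
  because the arcs are symmetric, which gives the factor 2.\<close>

lemma adjacency_form_add:
  "adjacency_form G (\<lambda>v. f v + t * g v) = adjacency_form G f
     + 2 * t * (\<Sum>u\<in>pverts G. g u * (\<Sum>v\<in>pverts G. if (u, v) \<in> parcs G then f v else 0))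
     + t\<^sup>2 * adjacency_form G g"
proof -
  let ?V = "pverts G"
  let ?a = "\<lambda>u v. of_bool ((u, v) \<in> parcs G) :: real"
  have sym: "?a u v = ?a v u" for u v
    using arcs_symmetric by auto
  have form: "adjacency_form G h = (\<Sum>u\<in>?V. \<Sum>v\<in>?V. ?a u v * (h u * h v))" for h
    unfolding adjacency_form_def by (intro sum.cong) auto
  have cross: "(\<Sum>u\<in>?V. \<Sum>v\<in>?V. ?a u v * (f u * g v)) = (\<Sum>u\<in>?V. \<Sum>v\<in>?V. ?a u v * (g u * f v))"
    by (subst sum.swap, intro sum.cong refl) (simp add: sym mult.commute)
  have lin: "(\<Sum>u\<in>?V. g u * (\<Sum>v\<in>?V. if (u, v) \<in> parcs G then f v else 0)) =
     (\<Sum>u\<in>?V. \<Sum>v\<in>?V. ?a u v * (g u * f v))"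
    unfolding sum_distrib_left by (intro sum.cong) auto
  have "adjacency_form G (\<lambda>v. f v + t * g v) =
    (\<Sum>u\<in>?V. \<Sum>v\<in>?V. ?a u v * (f u * f v) + t * (?a u v * (f u * g v))
      + t * (?a u v * (g u * f v)) + t\<^sup>2 * (?a u v * (g u * g v)))"
    unfolding form by (intro sum.cong refl) (simp add: algebra_simps power2_eq_square)
  also have "\<dots> = adjacency_form G f + t * (\<Sum>u\<in>?V. \<Sum>v\<in>?V. ?a u v * (f u * g v))
      + t * (\<Sum>u\<in>?V. \<Sum>v\<in>?V. ?a u v * (g u * f v)) + t\<^sup>2 * adjacency_form G g"
    unfolding form by (simp only: sum.distrib sum_distrib_left)
  finally show ?thesis
    unfolding cross lin by simp
qed

text \<open>First-order condition: moving \<open>f\<close> along the unit vector at \<open>w\<close>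
  cannot violate the bound, so the term linear in \<open>t\<close> must vanish, and this term is the
  eigenvalue equation at \<open>w\<close>.\<close>

lemma maximizer_is_eigenvector:
  assumes max: "\<And>g. adjacency_form G g \<le> k * (\<Sum>v\<in>pverts G. (g v)\<^sup>2)"
    and eq: "adjacency_form G f = k * (\<Sum>v\<in>pverts G. (f v)\<^sup>2)"
    and w: "w \<in> pverts G"
  shows "(\<Sum>v\<in>pverts G. if (w, v) \<in> parcs G then f v else 0) = k * f w"
proof -
  let ?V = "pverts G"
  let ?Af = "\<Sum>v\<in>?V. if (w, v) \<in> parcs G then f v else 0"
  define e :: "'a \<Rightarrow> real" where "e v = of_bool (v = w)" for v
  \<comment> \<open>Used with \<open>h = f\<close> for the cross terms, and with
    \<open>h = 1\<close> for the squared norm of \<open>e\<close>, since \<open>e\<close> takes only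
    the values 0 and 1.\<close>
  have unit: "(\<Sum>v\<in>?V. e v * h v) = h w" for h
    using w pair_finite_verts by (simp add: e_def sum.remove[where x = w])
  have le: "2 * t * (?Af - k * f w) \<le> t\<^sup>2 * (k - adjacency_form G e)" for t
  proof -
    have "adjacency_form G (\<lambda>v. f v + t * e v) = adjacency_form G f + 2 * t * ?Af + t\<^sup>2 * adjacency_form G e"
      unfolding adjacency_form_add unit ..
    moreover have "(\<Sum>v\<in>?V. (f v + t * e v)\<^sup>2) =
        (\<Sum>v\<in>?V. (f v)\<^sup>2) + 2 * t * (\<Sum>v\<in>?V. e v * f v) + t\<^sup>2 * (\<Sum>v\<in>?V. e v * 1)"
      unfolding sum_distrib_left sum.distrib[symmetric]
      by (intro sum.cong) (auto simp: e_def power2_eq_square algebra_simps)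
    ultimately show ?thesis
      using max[of "\<lambda>v. f v + t * e v"] unfolding unit[of f] unit[of "\<lambda>_. 1"]
      by (simp add: eq algebra_simps)
  qed
  \<comment> \<open>\<open>c\<close> is the defect in the eigenvalue equation at \<open>w\<close>.
    As \<open>d\<close> is positive and exceeds the coefficient of the quadratic term, the choice
    \<open>t = c / d\<close> turns \<open>le\<close> into 2c^2/d \<le> c^2/d, so
    \<open>c = 0\<close>.\<close>
  define c d where "c = ?Af - k * f w" and "d = \<bar>k - adjacency_form G e\<bar> + 1"
  have d: "d > 0" "k - adjacency_form G e < d"
    by (auto simp: d_def)
  have "2 * (c / d) * c \<le> (c / d)\<^sup>2 * (k - adjacency_form G e)"
    using le[of "c / d"] by (simp add: c_def)
  also have "\<dots> \<le> (c / d)\<^sup>2 * d"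
    using d by (intro mult_left_mono) auto
  also have "\<dots> = (c / d) * c"
    using d by (simp add: power2_eq_square)
  finally have "c * c / d \<le> 0"
    by simp
  then have "c * c \<le> 0"
    using d by (simp add: divide_le_0_iff)
  then have "c = 0"
    by (metis mult_eq_0_iff order_antisym zero_le_square)
  then show ?thesis
    by (simp add: c_def)
qed

text \<open>The maximum \<open>k\<close> of the form on the unit sphere is an eigenvalue because a
  maximiser is an eigenvector. Evaluating the form at an eigenvector for \<open>x\<close> gives
  \<open>x\<close> times its squared norm, so no eigenvalue exceeds \<open>k\<close>.\<close>

lemma spectral_radius_rayleigh:
  assumes ne: "pverts G \<noteq> {}"
  shows "adjacency_form G g \<le> graph_spectral_radius G * (\<Sum>v\<in>pverts G. (g v)\<^sup>2)"
    and "\<exists>f. (\<Sum>v\<in>pverts G. (f v)\<^sup>2) = 1 \<and> (\<forall>v. f v \<ge> 0) \<and>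
      adjacency_form G f = graph_spectral_radius G"
proof -
  let ?V = "pverts G"
  obtain f where f: "(\<Sum>v\<in>?V. (f v)\<^sup>2) = 1"
    "\<And>g. adjacency_form G g \<le> adjacency_form G f * (\<Sum>v\<in>?V. (g v)\<^sup>2)"
    by (rule adjacency_form_maximum[OF pair_finite_verts ne]) blast
  obtain xs where xs: "distinct xs" "set xs = ?V"
    using pair_finite_verts finite_distinct_list by blast
  define k where "k = adjacency_form G f"
  have spec: "x \<in> spectrum (adjacency_matrix G) \<longleftrightarrow> (\<exists>h. (\<exists>u\<in>?V. h u \<noteq> 0) \<and>
      (\<forall>u\<in>?V. (\<Sum>v\<in>?V. if (u, v) \<in> parcs G then h v else 0) = x * h u))" for x
    unfolding spectrum_adjacency_matrix[OF xs]
    by (simp add: spectrum_def eigenvalue_adjacency_matrix_of[OF xs(1)] xs(2))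
  have radius: "graph_spectral_radius G = k"
    unfolding graph_spectral_radius_def
  proof (rule Max_eqI)
    show "finite (spectrum (adjacency_matrix G))"
      unfolding spectrum_adjacency_matrix[OF xs]
      by (rule card_finite_spectrum(1)[of _ "length xs"]) (simp add: adjacency_matrix_of_def)
    have "\<exists>u\<in>?V. f u \<noteq> 0"
    proof (rule ccontr)
      assume "\<not> ?thesis"
      then have "(\<Sum>v\<in>?V. (f v)\<^sup>2) = 0"
        by simp
      with f(1) show False
        by simp
    qed
    moreover have "(\<Sum>v\<in>?V. if (u, v) \<in> parcs G then f v else 0) = k * f u" if "u \<in> ?V" for u
      by (rule maximizer_is_eigenvector[OF _ _ that]) (simp_all only: k_def f mult_1_right)
    ultimately show "k \<in> spectrum (adjacency_matrix G)"
      unfolding spec by (intro exI[of _ f] conjI ballI)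
  next
    fix x assume "x \<in> spectrum (adjacency_matrix G)"
    then obtain h u where u: "u \<in> ?V" "h u \<noteq> 0"
      and h: "\<forall>u\<in>?V. (\<Sum>v\<in>?V. if (u, v) \<in> parcs G then h v else 0) = x * h u"
      unfolding spec by (elim exE conjE bexE)
    from u have pos: "(\<Sum>v\<in>?V. (h v)\<^sup>2) > 0"
      using pair_finite_verts by (intro sum_pos2[of _ u]) auto
    have "adjacency_form G h =
        (\<Sum>u\<in>?V. h u * (\<Sum>v\<in>?V. if (u, v) \<in> parcs G then h v else 0))"
      unfolding adjacency_form_def sum_distrib_left by (intro sum.cong) auto
    also have "\<dots> = (\<Sum>u\<in>?V. x * (h u)\<^sup>2)"
      by (intro sum.cong) (simp_all add: h power2_eq_square)
    also have "\<dots> = x * (\<Sum>v\<in>?V. (h v)\<^sup>2)"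
      by (simp only: sum_distrib_left)
    finally show "x \<le> k"
      using f(2)[of h] pos by (simp add: k_def)
  qed
  show "adjacency_form G g \<le> graph_spectral_radius G * (\<Sum>v\<in>?V. (g v)\<^sup>2)"
    unfolding radius k_def by (rule f(2))
  \<comment> \<open>The entries of the matrix are nonnegative, so passing to absolute values does
    not lower the form; a maximiser may thus be taken nonnegative.\<close>
  have "k \<le> adjacency_form G (\<lambda>v. \<bar>f v\<bar>)"
    unfolding k_def adjacency_form_def
    by (intro sum_mono) (auto simp flip: abs_mult)
  moreover have "adjacency_form G (\<lambda>v. \<bar>f v\<bar>) \<le> k"
    using f(2)[of "\<lambda>v. \<bar>f v\<bar>"] f(1) by (simp add: k_def)
  ultimately show "\<exists>f. (\<Sum>v\<in>?V. (f v)\<^sup>2) = 1 \<and> (\<forall>v. f v \<ge> 0) \<and>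
      adjacency_form G f = graph_spectral_radius G"
    using f(1) by (intro exI[of _ "\<lambda>v. \<bar>f v\<bar>"]) (simp add: radius)
qed

section \<open>Labelling the matching\<close>

lemma perfect_matching_edge:
  assumes "perfect_matching G M" "e \<in> M"
  obtains u v where "e = {u, v}" "(u, v) \<in> parcs G" "u \<noteq> v"
  using assms no_loops' unfolding perfect_matching_def edge_set_def by blast

lemma card_perfect_matching:
  assumes M: "perfect_matching G M"
  shows "finite M" "2 * card M = card (pverts G)"
proof -
  have "M \<subseteq> Pow (pverts G)"
    using M by (auto simp: perfect_matching_def)
  then show fin: "finite M"
    using pair_finite_verts by (meson finite_Pow_iff finite_subset)
  have two: "card e = 2" if e: "e \<in> M" for e
    using perfect_matching_edge[OF M e] by (metis card_2_iff)
  have "card (\<Union>M) = sum card M"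
  proof (rule card_Union_disjoint)
    show "pairwise disjnt M"
      using M by (simp add: perfect_matching_def)
    show "finite e" if "e \<in> M" for e
      using two[OF that] by (simp add: card_ge_0_finite)
  qed
  with two M show "2 * card M = card (pverts G)"
    by (simp add: perfect_matching_def)
qed

text \<open>Exchanging the matching edges \<open>{p, q}\<close> and \<open>{r, s}\<close> for
  \<open>{p, r}\<close> and \<open>{q, s}\<close> gives another perfect matching. It differs from
  \<open>M\<close>, since \<open>{p, r}\<close> meets \<open>{p, q}\<close> in \<open>p\<close>
  without being equal to it.\<close>

lemma no_alternating_square:
  assumes M: "perfect_matching G M" and unique: "\<And>M'. perfect_matching G M' \<Longrightarrow> M' = M"
    and e: "{p, q} \<in> M" "{r, s} \<in> M" "{p, q} \<noteq> {r, s}"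
    and arcs: "(p, r) \<in> parcs G" "(q, s) \<in> parcs G"
  shows False
proof -
  have sub: "M \<subseteq> edge_set G" and disj: "pairwise disjnt M" and cover: "\<Union>M = pverts G"
    using M by (auto simp: perfect_matching_def)
  have neq: "p \<noteq> q" "r \<noteq> s"
    using perfect_matching_edge[OF M e(1)] perfect_matching_edge[OF M e(2)]
    by (metis doubleton_eq_iff)+
  have d: "disjnt {p, q} {r, s}"
    by (rule pairwiseD[OF disj e])
  define N where "N = M - {{p, q}, {r, s}}"
  define M' where "M' = N \<union> {{p, r}, {q, s}}"
  have M_eq: "M = N \<union> {{p, q}, {r, s}}"
    using e by (auto simp: N_def)
  have pm: "perfect_matching G M'"
    unfolding perfect_matching_def
  proof (intro conjI)
    show "M' \<subseteq> edge_set G"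
      using sub arcs by (auto simp: M'_def M_eq edge_set_def)
    have rest: "disjnt e {p, q, r, s}" if "e \<in> N" for e
    proof -
      have "disjnt e {p, q}" "disjnt e {r, s}"
        using pairwiseD[OF disj _ e(1), of e] pairwiseD[OF disj _ e(2), of e] that by (simp_all add: N_def)
      then show ?thesis
        by (auto simp: disjnt_def)
    qed
    show "pairwise disjnt M'"
      unfolding pairwise_def
    proof (intro ballI impI)
      fix x y assume xy: "x \<in> M'" "y \<in> M'" "x \<noteq> y"
      consider "x \<in> N" "y \<in> N"
        | "x \<in> N" "y \<in> {{p, r}, {q, s}}"
        | "x \<in> {{p, r}, {q, s}}" "y \<in> N"
        | "x \<in> {{p, r}, {q, s}}" "y \<in> {{p, r}, {q, s}}"
        using xy(1,2) unfolding M'_def Un_iff by metis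
      then show "disjnt x y"
      proof cases
        case 1
        with pairwiseD[OF disj, of x y] xy(3) M_eq show ?thesis
          by simp
      next
        case 2
        with rest[of x] show ?thesis
          by (auto simp: disjnt_def)
      next
        case 3
        with rest[of y] show ?thesis
          by (auto simp: disjnt_def)
      next
        case 4
        with xy(3) d neq show ?thesis
          by (auto simp: disjnt_def)
      qed
    qed
    have "\<Union>M' = \<Union>N \<union> ({p, q} \<union> {r, s})"
      unfolding M'_def by auto
    also have "\<dots> = \<Union>M"
      unfolding M_eq by auto
    finally show "\<Union>M' = pverts G"
      using cover by simp
  qed
  have "{p, r} \<in> M'"
    by (simp add: M'_def)
  then have "{p, r} \<in> M"
    using unique[OF pm] by simp
  moreover have "{p, r} \<noteq> {p, q}"
    using d by (auto simp: disjnt_def doubleton_eq_iff)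
  ultimately have "disjnt {p, r} {p, q}"
    using pairwiseD[OF disj _ e(1)] by blast
  then show False
    by (simp add: disjnt_def)
qed

text \<open>\<open>\<phi>\<close> is onto because the matching covers all vertices, and injective by
  counting. The last two conclusions exclude the two ways in which a pair of matching edges can lie
  on an alternating 4-cycle.\<close>

lemma sorted_matching_labelling:
  fixes f :: "'a \<Rightarrow> real"
  assumes card: "card (pverts G) = 2 * n" and unique: "\<exists>!M. perfect_matching G M"
  obtains \<phi> where "bij_betw \<phi> (pverts (G2n1 n)) (pverts G)"
    "\<And>i. i \<in> {1..n} \<Longrightarrow> (\<phi> (Inl i), \<phi> (Inr i)) \<in> parcs G"
    "\<And>i. i \<in> {1..n} \<Longrightarrow> f (\<phi> (Inl i)) \<le> f (\<phi> (Inr i))"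
    "\<And>i j. 1 \<le> i \<Longrightarrow> i < j \<Longrightarrow> j \<le> n \<Longrightarrow>
      f (\<phi> (Inl i)) / f (\<phi> (Inr i)) \<le> f (\<phi> (Inl j)) / f (\<phi> (Inr j))"
    "\<And>i j. i \<in> {1..n} \<Longrightarrow> j \<in> {1..n} \<Longrightarrow> i \<noteq> j \<Longrightarrow>
      \<not> ((\<phi> (Inl i), \<phi> (Inl j)) \<in> parcs G \<and> (\<phi> (Inr i), \<phi> (Inr j)) \<in> parcs G)"
    "\<And>i j. i \<in> {1..n} \<Longrightarrow> j \<in> {1..n} \<Longrightarrow> i \<noteq> j \<Longrightarrow>
      \<not> ((\<phi> (Inl i), \<phi> (Inr j)) \<in> parcs G \<and> (\<phi> (Inr i), \<phi> (Inl j)) \<in> parcs G)"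
proof -
  obtain M where M: "perfect_matching G M" and uniq: "\<And>M'. perfect_matching G M' \<Longrightarrow> M' = M"
    using unique by blast
  have "\<exists>u v. e = {u, v} \<and> (u, v) \<in> parcs G \<and> f u \<le> f v" if e: "e \<in> M" for e
  proof -
    obtain u v where "e = {u, v}" "(u, v) \<in> parcs G"
      using perfect_matching_edge[OF M e] by blast
    moreover from this have "e = {v, u}" "(v, u) \<in> parcs G"
      using arcs_symmetric by (auto simp: insert_commute)
    moreover have "f u \<le> f v \<or> f v \<le> f u"
      by linarith
    ultimately show ?thesis
      by blast
  qed
  then obtain a b where ab: "\<And>e. e \<in> M \<Longrightarrow> e = {a e, b e}"
    "\<And>e. e \<in> M \<Longrightarrow> (a e, b e) \<in> parcs G" "\<And>e. e \<in> M \<Longrightarrow> f (a e) \<le> f (b e)"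
    by metis
  obtain ys where ys: "distinct ys" "set ys = M"
    using card_perfect_matching(1)[OF M] finite_distinct_list by blast
  define xs where "xs = sort_key (\<lambda>e. f (a e) / f (b e)) ys"
  have xs: "distinct xs" "set xs = M" "sorted (map (\<lambda>e. f (a e) / f (b e)) xs)"
    using ys by (auto simp: xs_def)
  have len: "length xs = n"
    using card_perfect_matching(2)[OF M] card distinct_card[OF xs(1)] xs(2) by simp
  \<comment> \<open>Labels run from 1 to \<open>n\<close>, list positions from 0.\<close>
  define g where "g i = xs ! (i - 1)" for i
  have gM: "g i \<in> M" if "i \<in> {1..n}" for i
    using that len xs(2) nth_mem[of "i - 1" xs] by (auto simp: g_def)
  have g_inj: "i = j" if "g i = g j" "i \<in> {1..n}" "j \<in> {1..n}" for i j
  proof -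
    have "i - 1 = j - 1"
      using that len xs(1) nth_eq_iff_index_eq[of xs "i - 1" "j - 1"] by (auto simp: g_def)
    with that show ?thesis
      by auto
  qed
  have g_surj: "\<exists>i\<in>{1..n}. g i = e" if e: "e \<in> M" for e
  proof -
    obtain k where "k < n" "xs ! k = e"
      using e xs(2) len by (auto simp: in_set_conv_nth)
    then show ?thesis
      by (intro bexI[of _ "Suc k"]) (simp_all add: g_def)
  qed
  define \<phi> where "\<phi> = case_sum (\<lambda>i. a (g i)) (\<lambda>i. b (g i))"
  have phi: "\<phi> (Inl i) = a (g i)" "\<phi> (Inr i) = b (g i)" for i
    by (simp_all add: \<phi>_def)
  have "\<phi> ` pverts (G2n1 n) = (\<Union>i\<in>{1..n}. {a (g i), b (g i)})"
    by (auto simp: G2n1_def phi image_Un image_image)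
  also have "\<dots> = (\<Union>i\<in>{1..n}. g i)"
    using ab(1)[OF gM] by (intro SUP_cong) auto
  also have "\<dots> = \<Union>M"
    using gM g_surj by blast
  also have "\<dots> = pverts G"
    using M by (simp add: perfect_matching_def)
  finally have im: "\<phi> ` pverts (G2n1 n) = pverts G" .
  moreover have "finite (pverts (G2n1 n))"
    by (simp add: G2n1_def)
  ultimately have "inj_on \<phi> (pverts (G2n1 n))"
    by (intro eq_card_imp_inj_on) (simp_all add: card card_pverts_G2n1)
  with im have bij: "bij_betw \<phi> (pverts (G2n1 n)) (pverts G)"
    by (simp add: bij_betw_def)
  have pair: "{a (g i), b (g i)} \<in> M" if "i \<in> {1..n}" for i
    using ab(1) gM that by metis
  have pair_neq: "{a (g i), b (g i)} \<noteq> {a (g j), b (g j)}"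
    if "i \<in> {1..n}" "j \<in> {1..n}" "i \<noteq> j" for i j
    using ab(1) gM g_inj that by metis
  show ?thesis
  proof (rule that[OF bij])
    show "(\<phi> (Inl i), \<phi> (Inr i)) \<in> parcs G" "f (\<phi> (Inl i)) \<le> f (\<phi> (Inr i))"
      if "i \<in> {1..n}" for i
      using ab(2,3) gM that by (auto simp: phi)
    show "f (\<phi> (Inl i)) / f (\<phi> (Inr i)) \<le> f (\<phi> (Inl j)) / f (\<phi> (Inr j))"
      if "1 \<le> i" "i < j" "j \<le> n" for i j
      using sorted_nth_mono[OF xs(3), of "i - 1" "j - 1"] that len by (simp add: phi g_def)
    show "\<not> ((\<phi> (Inl i), \<phi> (Inl j)) \<in> parcs G \<and> (\<phi> (Inr i), \<phi> (Inr j)) \<in> parcs G)"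
      if "i \<in> {1..n}" "j \<in> {1..n}" "i \<noteq> j" for i j
      using no_alternating_square[OF M uniq pair pair pair_neq] that by (auto simp: phi)
    show "\<not> ((\<phi> (Inl i), \<phi> (Inr j)) \<in> parcs G \<and> (\<phi> (Inr i), \<phi> (Inl j)) \<in> parcs G)"
      if ij: "i \<in> {1..n}" "j \<in> {1..n}" "i \<noteq> j" for i j
    proof -
      \<comment> \<open>Reading the second matching edge backwards turns the other type of 4-cycle
        into the one already excluded.\<close>
      have "{b (g j), a (g j)} \<in> M" "{a (g i), b (g i)} \<noteq> {b (g j), a (g j)}"
        using pair[OF ij(2)] pair_neq[OF ij] by (simp_all add: insert_commute)
      from no_alternating_square[OF M uniq pair[OF ij(1)] this] show ?thesis
        by (auto simp: phi)
    qed
  qed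
qed

end

section \<open>Comparison with the extremal graph\<close>

text \<open>Grouping the vertices by matching edges splits the adjacency matrix into 2x2 blocks;
  this is the share of block \<open>(i, j)\<close> in the quadratic form. Graphs can then be
  compared one pair of matching edges at a time.\<close>

definition block_form :: "('b + 'b) rel \<Rightarrow> ('b + 'b \<Rightarrow> real) \<Rightarrow> 'b \<Rightarrow> 'b \<Rightarrow> real" where
  "block_form R h i j = (let c = \<lambda>p q. if (p, q) \<in> R then h p * h q else 0 in
     c (Inl i) (Inl j) + c (Inl i) (Inr j) + c (Inr i) (Inl j) + c (Inr i) (Inr j))"

lemma sum_pverts_G2n1:
  "(\<Sum>p\<in>pverts (G2n1 n). (h p :: real)) = (\<Sum>i=1..n. h (Inl i) + h (Inr i))"
proof -
  have "(\<Sum>p\<in>pverts (G2n1 n). h p) = (\<Sum>p\<in>Inl ` {1..n}. h p) + (\<Sum>p\<in>Inr ` {1..n}. h p)"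
    unfolding G2n1_def pair_pre_digraph.simps by (rule sum.union_disjoint) auto
  then show ?thesis
    by (simp add: sum.reindex sum.distrib)
qed

lemma block_form_decomposition:
  "(\<Sum>p\<in>pverts (G2n1 n). \<Sum>q\<in>pverts (G2n1 n). if (p, q) \<in> R then h p * h q else 0) =
   (\<Sum>i=1..n. \<Sum>j=1..n. block_form R h i j)"
  unfolding sum_pverts_G2n1 sum.distrib[symmetric] block_form_def Let_def
  by (intro sum.cong refl) simp

lemma block_form_commute:
  assumes "sym R"
  shows "block_form R h i j = block_form R h j i"
proof -
  have R: "(p, q) \<in> R \<longleftrightarrow> (q, p) \<in> R" for p q
    using assms by (meson symD)
  show ?thesis
    unfolding block_form_def Let_def
    using R[of "Inl i" "Inl j"] R[of "Inl i" "Inr j"] R[of "Inr i" "Inl j"] R[of "Inr i" "Inr j"]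
    by (simp add: mult.commute)
qed

lemma parcs_G2n1_iff:
  "(Inl i, Inl j) \<in> parcs (G2n1 n) \<longleftrightarrow> False"
  "(Inl i, Inr j) \<in> parcs (G2n1 n) \<longleftrightarrow> i \<in> {1..n} \<and> j \<in> {1..i}"
  "(Inr j, Inl i) \<in> parcs (G2n1 n) \<longleftrightarrow> i \<in> {1..n} \<and> j \<in> {1..i}"
  "(Inr i, Inr j) \<in> parcs (G2n1 n) \<longleftrightarrow> i \<in> {1..n} \<and> j \<in> {1..n} \<and> i \<noteq> j"
  by (auto simp: G2n1_def)

lemma sym_parcs_G2n1: "sym (parcs (G2n1 n))"
  by (auto simp: G2n1_def intro!: symI)

text \<open>Models \<open>G\<close> pulled back along the labelling: \<open>R\<close> stands for its
  arcs and \<open>h\<close> for its nonnegative eigenvector, both on the vertices of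
  \<open>G2n1 n\<close>, so that the two quadratic forms are evaluated at the same vector.\<close>

locale matched_relation =
  fixes n :: nat and R :: "(nat + nat) rel" and h :: "nat + nat \<Rightarrow> real"
  assumes sym: "sym R"
    and irrefl: "(p, p) \<notin> R"
    and matched: "i \<in> {1..n} \<Longrightarrow> (Inl i, Inr i) \<in> R"
    and no_square: "i \<in> {1..n} \<Longrightarrow> j \<in> {1..n} \<Longrightarrow> i \<noteq> j \<Longrightarrow>
      \<not> ((Inl i, Inl j) \<in> R \<and> (Inr i, Inr j) \<in> R)"
      "i \<in> {1..n} \<Longrightarrow> j \<in> {1..n} \<Longrightarrow> i \<noteq> j \<Longrightarrow>
      \<not> ((Inl i, Inr j) \<in> R \<and> (Inr i, Inl j) \<in> R)"
    and nonneg: "h p \<ge> 0"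
    and u_le_w: "i \<in> {1..n} \<Longrightarrow> h (Inl i) \<le> h (Inr i)"
    and ratio: "1 \<le> i \<Longrightarrow> i < j \<Longrightarrow> j \<le> n \<Longrightarrow> h (Inl i) / h (Inr i) \<le> h (Inl j) / h (Inr j)"
begin

text \<open>Where \<open>h (Inr i) = 0\<close>, also \<open>h (Inl i) = 0\<close>, so the junk value of the quotient is harmless.\<close>

lemma cross_le:
  assumes "1 \<le> i" "i < j" "j \<le> n"
  shows "h (Inl i) * h (Inr j) \<le> h (Inr i) * h (Inl j)"
proof (cases "h (Inr i) = 0 \<or> h (Inr j) = 0")
  case True
  then show ?thesis
    using u_le_w[of i] assms nonneg[of "Inl i"] nonneg[of "Inr i"] nonneg[of "Inl j"] by force
next
  case False
  then have "h (Inr i) > 0" "h (Inr j) > 0"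
    using nonneg by (simp_all add: less_le)
  with ratio[OF assms] show ?thesis
    by (simp add: field_simps)
qed

text \<open>Within one matching pair, both graphs have just the matching edge.\<close>

lemma block_form_diagonal:
  assumes "i \<in> {1..n}"
  shows "block_form R h i i = block_form (parcs (G2n1 n)) h i i"
proof -
  have "(Inr i, Inl i) \<in> R"
    using matched[OF assms] sym by (meson symD)
  with matched[OF assms] irrefl assms show ?thesis
    by (simp add: block_form_def parcs_G2n1_iff)
qed

text \<open>\<open>R\<close> contains at most one edge from each of the two pairs excluded by
  \<open>no_square\<close>. For \<open>i < j\<close> the extremal graph has the heavier edge of
  each: \<open>Inr i\<close>-\<open>Inr j\<close>, since \<open>h\<close> is larger on the
  \<open>Inr\<close> side, and \<open>Inr i\<close>-\<open>Inl j\<close>, by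
  \<open>cross_le\<close>.\<close>

lemma block_form_le_less:
  assumes ij: "1 \<le> i" "i < j" "j \<le> n"
  shows "block_form R h i j \<le> block_form (parcs (G2n1 n)) h i j"
proof -
  have "h (Inl i) * h (Inl j) \<le> h (Inr i) * h (Inr j)"
    using u_le_w[of i] u_le_w[of j] nonneg ij by (intro mult_mono) auto
  moreover have "0 \<le> h (Inr i) * h (Inl j)" "0 \<le> h (Inr i) * h (Inr j)"
    using nonneg by simp_all
  ultimately show ?thesis
    using no_square[of i j] cross_le[OF ij] ij
    by (auto simp: block_form_def parcs_G2n1_iff)
qed

lemma block_form_le:
  assumes "i \<in> {1..n}" "j \<in> {1..n}"
  shows "block_form R h i j \<le> block_form (parcs (G2n1 n)) h i j"
proof (cases i j rule: linorder_cases)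
  case greater
  with assms block_form_le_less[of j i] show ?thesis
    unfolding block_form_commute[OF sym, of h i] block_form_commute[OF sym_parcs_G2n1, of n h i]
    by simp
qed (use assms block_form_le_less block_form_diagonal in auto)

lemma form_le:
  "(\<Sum>p\<in>pverts (G2n1 n). \<Sum>q\<in>pverts (G2n1 n). if (p, q) \<in> R then h p * h q else 0)
     \<le> adjacency_form (G2n1 n) h"
  unfolding adjacency_form_def block_form_decomposition
  by (intro sum_mono block_form_le)

text \<open>Equality of the totals forces equality in every block. With \<open>h\<close> positive
  and strictly monotone on both sides, the maximum of a block is attained only by the edges of the
  extremal graph.\<close>

lemma rel_eq:
  assumes eq: "(\<Sum>p\<in>pverts (G2n1 n). \<Sum>q\<in>pverts (G2n1 n). if (p, q) \<in> R then h p * h q else 0)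
      = adjacency_form (G2n1 n) h"
    and pos: "\<And>p. p \<in> pverts (G2n1 n) \<Longrightarrow> h p > 0"
    and u_less: "\<And>i j. 1 \<le> i \<Longrightarrow> i < j \<Longrightarrow> j \<le> n \<Longrightarrow> h (Inl i) < h (Inl j)"
    and w_less: "\<And>i j. 1 \<le> i \<Longrightarrow> i < j \<Longrightarrow> j \<le> n \<Longrightarrow> h (Inr j) < h (Inr i)"
    and p: "p \<in> pverts (G2n1 n)" and q: "q \<in> pverts (G2n1 n)"
  shows "(p, q) \<in> R \<longleftrightarrow> (p, q) \<in> parcs (G2n1 n)"
proof -
  \<comment> \<open>Sums that agree while their terms are ordered agree term by term. This is
    applied first to the rows and then, in \<open>blocks\<close>, to the entries of a row.\<close>
  have outer: "(\<Sum>j=1..n. block_form R h i j) = (\<Sum>j=1..n. block_form (parcs (G2n1 n)) h i j)"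
    if "i \<in> {1..n}" for i
    by (rule sum_mono_inv[OF eq[unfolded adjacency_form_def block_form_decomposition]])
      (use that in \<open>auto intro!: sum_mono block_form_le\<close>)
  have blocks: "block_form R h i j = block_form (parcs (G2n1 n)) h i j"
    if "i \<in> {1..n}" "j \<in> {1..n}" for i j
    by (rule sum_mono_inv[OF outer[OF that(1)]]) (use that in \<open>auto intro!: block_form_le\<close>)
  have R_sym: "(x, y) \<in> R \<longleftrightarrow> (y, x) \<in> R" for x y
    using sym by (meson symD)
  have less: "(Inl i, Inl j) \<notin> R \<and> (Inl i, Inr j) \<notin> R \<and> (Inr i, Inl j) \<in> R \<and> (Inr i, Inr j) \<in> R"
    if ij: "1 \<le> i" "i < j" "j \<le> n" for i j
  proof -
    have pos': "h (Inl i) > 0" "h (Inr i) > 0" "h (Inl j) > 0" "h (Inr j) > 0"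
      using pos ij by (auto simp: G2n1_def)
    have cross: "h (Inl i) * h (Inr j) < h (Inr i) * h (Inl j)"
      using mult_strict_mono[OF u_less[OF ij] w_less[OF ij]] pos' by (simp add: mult.commute)
    \<comment> \<open>The chain is u_i < u_j \<le> w_j < w_i in terms of the values of
      \<open>h\<close>.\<close>
    have "h (Inl i) < h (Inr i)"
      using u_less[OF ij] u_le_w[of j] w_less[OF ij] ij by auto
    then have same: "h (Inl i) * h (Inl j) < h (Inr i) * h (Inr j)"
      using u_le_w[of j] pos' ij by (intro mult_less_le_imp_less) auto
    \<comment> \<open>Positive weights mean that omitting both edges of an excluded pair also makes
      the block strictly smaller.\<close>
    have pp: "h (Inl i) * h (Inl j) > 0" "h (Inl i) * h (Inr j) > 0"
        "h (Inr i) * h (Inl j) > 0" "h (Inr i) * h (Inr j) > 0"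
      using pos' by simp_all
    have "block_form R h i j = block_form (parcs (G2n1 n)) h i j"
      using blocks ij by simp
    then show ?thesis
      using no_square[of i j] cross same ij pp
      by (auto simp: block_form_def parcs_G2n1_iff split: if_splits)
  qed
  show ?thesis
  proof (cases p; cases q)
    fix i j assume "p = Inl i" "q = Inl j"
    with p q less[of i j] less[of j i] irrefl[of p] R_sym show ?thesis
      by (cases i j rule: linorder_cases) (auto simp: G2n1_def)
  next
    fix i j assume "p = Inl i" "q = Inr j"
    with p q less[of i j] less[of j i] matched[of i] R_sym show ?thesis
      by (cases i j rule: linorder_cases) (auto simp: G2n1_def)
  next
    fix i j assume "p = Inr i" "q = Inl j"
    with p q less[of i j] less[of j i] matched[of i] R_sym show ?thesis
      by (cases i j rule: linorder_cases) (auto simp: G2n1_def)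
  next
    fix i j assume "p = Inr i" "q = Inr j"
    with p q less[of i j] less[of j i] irrefl[of p] R_sym show ?thesis
      by (cases i j rule: linorder_cases) (auto simp: G2n1_def)
  qed
qed

end

section \<open>Nonnegative eigenvectors of the extremal graph\<close>

text \<open>Positivity spreads from \<open>Inr 1\<close>, which is adjacent to every other vertex.
  Monotonicity comes from nesting: the neighbourhoods of the \<open>Inl i\<close> grow with
  \<open>i\<close>, and the closed neighbourhoods of the \<open>Inr i\<close> shrink, strictly in
  both cases.\<close>

lemma G2n1_eigenvector:
  fixes h :: "nat + nat \<Rightarrow> real"
  assumes n: "n \<ge> 1" and k: "k > 0"
    and eigen: "\<And>p. p \<in> pverts (G2n1 n) \<Longrightarrow>
      (\<Sum>q\<in>pverts (G2n1 n). if (p, q) \<in> parcs (G2n1 n) then h q else 0) = k * h p"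
    and nonneg: "\<And>p. h p \<ge> 0" and nonzero: "\<exists>p\<in>pverts (G2n1 n). h p \<noteq> 0"
  shows "\<And>p. p \<in> pverts (G2n1 n) \<Longrightarrow> h p > 0"
    and "\<And>i j. 1 \<le> i \<Longrightarrow> i < j \<Longrightarrow> j \<le> n \<Longrightarrow> h (Inl i) < h (Inl j)"
    and "\<And>i j. 1 \<le> i \<Longrightarrow> i < j \<Longrightarrow> j \<le> n \<Longrightarrow> h (Inr j) < h (Inr i)"
proof -
  let ?H = "G2n1 n" and ?V = "pverts (G2n1 n)"
  have fin: "finite ?V"
    by (simp add: G2n1_def)
  have w1: "Inr 1 \<in> ?V"
    using n by (auto simp: G2n1_def)
  have adj1: "(Inr 1, p) \<in> parcs ?H" "(p, Inr 1) \<in> parcs ?H" if "p \<in> ?V" "p \<noteq> Inr 1" for p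
    using that n by (auto simp: G2n1_def)
  have nbr_le: "h q \<le> k * h p" if "p \<in> ?V" "q \<in> ?V" "(p, q) \<in> parcs ?H" for p q
  proof -
    have "h q = (if (p, q) \<in> parcs ?H then h q else 0)"
      using that by simp
    also have "\<dots> \<le> (\<Sum>q\<in>?V. if (p, q) \<in> parcs ?H then h q else 0)"
      by (rule member_le_sum) (use that fin nonneg in auto)
    finally show ?thesis
      using eigen[OF that(1)] by simp
  qed
  \<comment> \<open>Each neighbour \<open>q\<close> of \<open>Inr 1\<close> satisfies
    \<open>h q \<le> k * h (Inr 1)\<close>, so a zero there would make \<open>h\<close> vanish
    everywhere.\<close>
  have "h (Inr 1) \<noteq> 0"
  proof
    assume "h (Inr 1) = 0"
    then have "h p = 0" if "p \<in> ?V" for p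
      using nbr_le[OF w1 that adj1(1)[OF that]] nonneg[of p] by (cases "p = Inr 1") auto
    with nonzero show False
      by blast
  qed
  then have w1_pos: "h (Inr 1) > 0"
    using nonneg by (simp add: less_le)
  show pos: "h p > 0" if "p \<in> ?V" for p
  proof (cases "p = Inr 1")
    case False
    have "0 < k * h p"
      using w1_pos nbr_le[OF that w1 adj1(2)[OF that False]] by linarith
    with k show ?thesis
      by (simp add: zero_less_mult_iff)
  qed (use w1_pos in simp)
  have u: "k * h (Inl i) = (\<Sum>m=1..n. if m \<le> i then h (Inr m) else 0)" if "i \<in> {1..n}" for i
  proof -
    have "Inl i \<in> ?V"
      using that by (auto simp: G2n1_def)
    from eigen[OF this] show ?thesis
      unfolding sum_pverts_G2n1 using that by (auto simp: parcs_G2n1_iff intro!: sum.cong)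
  qed
  \<comment> \<open>Adding \<open>h (Inr i)\<close> to both sides closes the neighbourhood. The sum
    over the clique is then the same for all \<open>i\<close>, and only the \<open>Inl\<close> terms
    distinguish them.\<close>
  have w: "(k + 1) * h (Inr i) = (\<Sum>m=1..n. h (Inr m) + (if i \<le> m then h (Inl m) else 0))"
    if i: "i \<in> {1..n}" for i
  proof -
    have "Inr i \<in> ?V"
      using that by (auto simp: G2n1_def)
    from eigen[OF this, symmetric]
    have "k * h (Inr i) = (\<Sum>m=1..n. (if m \<noteq> i then h (Inr m) else 0) + (if i \<le> m then h (Inl m) else 0))"
      unfolding sum_pverts_G2n1
      by (rule trans, intro sum.cong) (use i in \<open>auto simp: parcs_G2n1_iff\<close>)
    moreover have "(\<Sum>m=1..n. h (Inr m)) = h (Inr i) + (\<Sum>m=1..n. if m \<noteq> i then h (Inr m) else 0)"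
      using i by (simp add: sum.remove[where x = i] cong: if_cong)
    ultimately show ?thesis
      by (simp add: sum.distrib algebra_simps)
  qed
  show "h (Inl i) < h (Inl j)" if ij: "1 \<le> i" "i < j" "j \<le> n" for i j
  proof -
    have "h (Inr j) > 0"
      using pos ij by (auto simp: G2n1_def)
    then have "(\<Sum>m=1..n. if m \<le> i then h (Inr m) else 0) < (\<Sum>m=1..n. if m \<le> j then h (Inr m) else 0)"
      using ij nonneg by (intro sum_strict_mono_ex1) (auto intro!: bexI[of _ j])
    then have "k * h (Inl i) < k * h (Inl j)"
      using u[of i] u[of j] ij by simp
    with k show ?thesis
      by simp
  qed
  show "h (Inr j) < h (Inr i)" if ij: "1 \<le> i" "i < j" "j \<le> n" for i j
  proof -
    have "h (Inl i) > 0"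
      using pos ij by (auto simp: G2n1_def)
    then have "(\<Sum>m=1..n. h (Inr m) + (if j \<le> m then h (Inl m) else 0))
        < (\<Sum>m=1..n. h (Inr m) + (if i \<le> m then h (Inl m) else 0))"
      using ij nonneg by (intro sum_strict_mono_ex1) (auto intro!: bexI[of _ i])
    then have "(k + 1) * h (Inr j) < (k + 1) * h (Inr i)"
      using w[of i] w[of j] ij by simp
    with k show ?thesis
      by simp
  qed
qed

section \<open>Graph isomorphisms as adjacency-preserving bijections\<close>

text \<open>An isomorphism of digraphs carries its own maps for arcs, tails and heads. Here tails
  and heads are the two projections, so the image of an arc is determined by the images of its
  ends.\<close>

lemma digraph_iso_bij_betw:
  assumes "digraph_iso (with_proj G) (with_proj H)"
  obtains \<phi> where "bij_betw \<phi> (pverts G) (pverts H)"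
    "\<And>u v. u \<in> pverts G \<Longrightarrow> v \<in> pverts G \<Longrightarrow> (\<phi> u, \<phi> v) \<in> parcs H \<longleftrightarrow> (u, v) \<in> parcs G"
proof -
  obtain F where F: "pre_digraph.digraph_isomorphism (with_proj G) F"
    and H: "with_proj H = app_iso F (with_proj G)"
    using assms by (auto simp: digraph_iso_def)
  let ?\<phi> = "iso_verts F"
  have wf: "wf_digraph (with_proj G)" and inj: "inj_on ?\<phi> (pverts G)"
    and ends: "\<And>a. a \<in> parcs G \<Longrightarrow> ?\<phi> (fst a) = iso_tail F (iso_arcs F a) \<and>
      ?\<phi> (snd a) = iso_head F (iso_arcs F a)"
    using F by (auto simp: pre_digraph.digraph_isomorphism_def)
  have vs: "pverts H = ?\<phi> ` pverts G" and "parcs H = iso_arcs F ` parcs G"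
    and th: "iso_tail F = fst" "iso_head F = snd"
    using H by (simp_all add: with_proj_def app_iso_def)
  moreover have arc: "iso_arcs F (u, v) = (?\<phi> u, ?\<phi> v)" if "(u, v) \<in> parcs G" for u v
    using ends[OF that] by (simp add: th prod_eq_iff)
  ultimately have as: "parcs H = (\<lambda>(u, v). (?\<phi> u, ?\<phi> v)) ` parcs G"
    by (auto intro!: image_cong)
  interpret pair_wf_digraph G
    using wf by (simp add: wf_digraph_wp_iff)
  show ?thesis
  proof (rule that)
    show "bij_betw ?\<phi> (pverts G) (pverts H)"
      using inj vs by (simp add: bij_betw_def)
    show "(?\<phi> u, ?\<phi> v) \<in> parcs H \<longleftrightarrow> (u, v) \<in> parcs G" if "u \<in> pverts G" "v \<in> pverts G" for u v
    proof
      assume "(?\<phi> u, ?\<phi> v) \<in> parcs H"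
      then obtain u' v' where "(u', v') \<in> parcs G" "?\<phi> u = ?\<phi> u'" "?\<phi> v = ?\<phi> v'"
        by (auto simp: as)
      then show "(u, v) \<in> parcs G"
        using that wellformed' inj_onD[OF inj] by metis
    qed (force simp: as)
  qed
qed

text \<open>The converse passage: the vertex bijection is applied componentwise to the arcs, with
  the projections as tail and head maps.\<close>

lemma digraph_isoI:
  assumes wf: "pair_wf_digraph G" "pair_wf_digraph H"
    and bij: "bij_betw \<phi> (pverts G) (pverts H)"
    and arcs: "\<And>u v. u \<in> pverts G \<Longrightarrow> v \<in> pverts G \<Longrightarrow> (\<phi> u, \<phi> v) \<in> parcs H \<longleftrightarrow> (u, v) \<in> parcs G"
  shows "digraph_iso (with_proj G) (with_proj H)"
proof -
  interpret G: pair_wf_digraph G by fact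
  interpret H: pair_wf_digraph H by fact
  let ?F = "\<lparr>iso_verts = \<phi>, iso_arcs = (\<lambda>(u, v). (\<phi> u, \<phi> v)), iso_head = snd, iso_tail = fst\<rparr>"
  have inj: "inj_on \<phi> (pverts G)" and im: "\<phi> ` pverts G = pverts H"
    using bij by (auto simp: bij_betw_def)
  have "inj_on (\<lambda>(u, v). (\<phi> u, \<phi> v)) (parcs G)"
    using inj G.wellformed' by (auto simp: inj_on_def)
  then have "pre_digraph.digraph_isomorphism (with_proj G) ?F"
    using wf inj by (auto simp: pre_digraph.digraph_isomorphism_def wf_digraph_wp_iff)
  moreover have "(\<lambda>(u, v). (\<phi> u, \<phi> v)) ` parcs G = parcs H"
  proof (intro equalityI subsetI)
    fix a assume "a \<in> parcs H"
    moreover from this obtain u v where "a = (\<phi> u, \<phi> v)" "u \<in> pverts G" "v \<in> pverts G"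
      using H.wellformed' im by (metis imageE surj_pair)
    ultimately show "a \<in> (\<lambda>(u, v). (\<phi> u, \<phi> v)) ` parcs G"
      using arcs by force
  qed (use arcs G.wellformed' in auto)
  then have "with_proj H = app_iso ?F (with_proj G)"
    by (simp add: app_iso_def with_proj_def im)
  ultimately show ?thesis
    unfolding digraph_iso_def by blast
qed

section \<open>The bound and the case of equality\<close>

lemma adjacency_form_reindex:
  assumes "bij_betw \<phi> V (pverts G)"
  shows "adjacency_form G f =
    (\<Sum>p\<in>V. \<Sum>q\<in>V. if (\<phi> p, \<phi> q) \<in> parcs G then f (\<phi> p) * f (\<phi> q) else 0)"
  unfolding adjacency_form_def
  by (simp only: sum.reindex_bij_betw[OF assms, symmetric])

theorem theorem1p1:
  fixes n :: nat and G :: "'a pair_pre_digraph"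
  assumes "n \<ge> 1"
    and "pair_graph G"
    and "Digraph_Component.connected (with_proj G)"
    and "card (pverts G) = 2 * n"
    and "\<exists>!M. perfect_matching G M"
  shows "graph_spectral_radius G \<le> graph_spectral_radius (G2n1 n)
    \<and> (graph_spectral_radius G = graph_spectral_radius (G2n1 n)
        \<longleftrightarrow> digraph_iso (with_proj G) (with_proj (G2n1 n)))"
proof -
  let ?H = "G2n1 n"
  interpret G: pair_graph G by fact
  interpret H: pair_graph ?H by (rule pair_graph_G2n1)
  have neG: "pverts G \<noteq> {}" and neH: "pverts ?H \<noteq> {}"
    using assms(1,4) card_pverts_G2n1[of n] by auto
  obtain f where f: "(\<Sum>v\<in>pverts G. (f v)\<^sup>2) = 1" "\<And>v. f v \<ge> 0"
    "adjacency_form G f = graph_spectral_radius G"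
    using G.spectral_radius_rayleigh(2)[OF neG] by blast
  obtain \<phi> where bij: "bij_betw \<phi> (pverts ?H) (pverts G)"
    and lab: "\<And>i. i \<in> {1..n} \<Longrightarrow> (\<phi> (Inl i), \<phi> (Inr i)) \<in> parcs G"
      "\<And>i. i \<in> {1..n} \<Longrightarrow> f (\<phi> (Inl i)) \<le> f (\<phi> (Inr i))"
      "\<And>i j. 1 \<le> i \<Longrightarrow> i < j \<Longrightarrow> j \<le> n \<Longrightarrow>
        f (\<phi> (Inl i)) / f (\<phi> (Inr i)) \<le> f (\<phi> (Inl j)) / f (\<phi> (Inr j))"
      "\<And>i j. i \<in> {1..n} \<Longrightarrow> j \<in> {1..n} \<Longrightarrow> i \<noteq> j \<Longrightarrow>
        \<not> ((\<phi> (Inl i), \<phi> (Inl j)) \<in> parcs G \<and> (\<phi> (Inr i), \<phi> (Inr j)) \<in> parcs G)"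
      "\<And>i j. i \<in> {1..n} \<Longrightarrow> j \<in> {1..n} \<Longrightarrow> i \<noteq> j \<Longrightarrow>
        \<not> ((\<phi> (Inl i), \<phi> (Inr j)) \<in> parcs G \<and> (\<phi> (Inr i), \<phi> (Inl j)) \<in> parcs G)"
    using G.sorted_matching_labelling[OF assms(4,5), of f] by blast
  define h where "h p = f (\<phi> p)" for p
  define R where "R = {(p, q). (\<phi> p, \<phi> q) \<in> parcs G}"
  interpret matched_relation n R h
  proof
    show "sym R"
      using G.arcs_symmetric by (auto simp: R_def intro!: symI)
    show "(p, p) \<notin> R" for p
      using G.no_loops' by (auto simp: R_def)
  qed (use lab f(2) in \<open>auto simp: R_def h_def\<close>)
  have form: "adjacency_form G f =
      (\<Sum>p\<in>pverts ?H. \<Sum>q\<in>pverts ?H. if (p, q) \<in> R then h p * h q else 0)"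
    unfolding adjacency_form_reindex[OF bij] R_def h_def by simp
  have norm: "(\<Sum>p\<in>pverts ?H. (h p)\<^sup>2) = 1"
    using f(1) by (simp add: h_def sum.reindex_bij_betw[OF bij, where g = "\<lambda>v. (f v)\<^sup>2"])
  note Hmax = H.spectral_radius_rayleigh(1)[OF neH]
  have formH: "adjacency_form ?H h \<le> graph_spectral_radius ?H"
    using Hmax[of h] norm by simp
  \<comment> \<open>The chain is: radius of \<open>G\<close> = form of \<open>G\<close> at
    \<open>f\<close> \<le> form of \<open>?H\<close> at \<open>h\<close> \<le> radius of
    \<open>?H\<close>.\<close>
  have le: "graph_spectral_radius G \<le> graph_spectral_radius ?H"
    using form_le form formH f(3) by linarith
  moreover have "digraph_iso (with_proj G) (with_proj ?H)"
    if eq: "graph_spectral_radius G = graph_spectral_radius ?H"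
  proof -
    \<comment> \<open>Equal radii make the whole chain an equality, so \<open>h\<close> attains the
      Rayleigh bound of \<open>?H\<close> and is an eigenvector of it.\<close>
    have "adjacency_form ?H h = graph_spectral_radius ?H"
      using form_le form formH f(3) eq by linarith
    then have eigen: "(\<Sum>q\<in>pverts ?H. if (p, q) \<in> parcs ?H then h q else 0) =
        graph_spectral_radius ?H * h p" if "p \<in> pverts ?H" for p
      using H.maximizer_is_eigenvector[OF Hmax _ that, of h] norm by simp
    \<comment> \<open>The all-ones vector shows that the radius of \<open>?H\<close> is positive;
      the edge between \<open>Inl 1\<close> and \<open>Inr 1\<close> already makes its form
      positive.\<close>
    have "0 < adjacency_form ?H (\<lambda>_. 1)"
      unfolding adjacency_form_def block_form_decomposition
      using assms(1)
      by (intro sum_pos2[where i = 1] sum_nonneg)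
        (auto simp: block_form_def parcs_G2n1_iff intro!: sum_pos2[where i = 1])
    also have "\<dots> \<le> graph_spectral_radius ?H * (2 * real n)"
      using Hmax[of "\<lambda>_. 1"] by (simp add: card_pverts_G2n1)
    finally have k: "graph_spectral_radius ?H > 0"
      by (simp add: zero_less_mult_iff)
    have "\<exists>p\<in>pverts ?H. h p \<noteq> 0"
    proof (rule ccontr)
      assume "\<not> ?thesis"
      then have "(\<Sum>p\<in>pverts ?H. (h p)\<^sup>2) = 0"
        by simp
      with norm show False
        by simp
    qed
    note * = G2n1_eigenvector[OF assms(1) k eigen nonneg this]
    have "(p, q) \<in> R \<longleftrightarrow> (p, q) \<in> parcs ?H" if "p \<in> pverts ?H" "q \<in> pverts ?H" for p q
      by (rule rel_eq) (use * that form formH form_le f(3) eq in auto)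
    \<comment> \<open>\<open>\<phi>\<close> maps the vertices of \<open>?H\<close> to those of
      \<open>G\<close>, so the isomorphism is obtained in this direction and then reversed.\<close>
    then have "digraph_iso (with_proj ?H) (with_proj G)"
      by (intro digraph_isoI[OF H.pair_wf_digraph G.pair_wf_digraph bij]) (auto simp: R_def)
    then show ?thesis
      by (rule digraph_iso_swap[OF H.wf_digraph_axioms])
  qed
  \<comment> \<open>A unit maximiser for \<open>?H\<close>, pulled back along the isomorphism, is a
    unit vector on \<open>G\<close> with the same form. Together with \<open>le\<close> this gives
    equality.\<close>
  moreover have "graph_spectral_radius ?H \<le> graph_spectral_radius G"
    if iso: "digraph_iso (with_proj G) (with_proj ?H)"
  proof -
    obtain \<psi> where bij': "bij_betw \<psi> (pverts G) (pverts ?H)"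
      and arcs: "\<And>u v. u \<in> pverts G \<Longrightarrow> v \<in> pverts G \<Longrightarrow> (\<psi> u, \<psi> v) \<in> parcs ?H \<longleftrightarrow> (u, v) \<in> parcs G"
      by (rule digraph_iso_bij_betw[OF iso]) blast
    obtain g where g: "(\<Sum>v\<in>pverts ?H. (g v)\<^sup>2) = 1" "adjacency_form ?H g = graph_spectral_radius ?H"
      using H.spectral_radius_rayleigh(2)[OF neH] by blast
    have "adjacency_form ?H g = adjacency_form G (\<lambda>u. g (\<psi> u))"
      unfolding adjacency_form_reindex[OF bij'] unfolding adjacency_form_def
      by (intro sum.cong refl) (simp add: arcs)
    also have "\<dots> \<le> graph_spectral_radius G * (\<Sum>u\<in>pverts G. (g (\<psi> u))\<^sup>2)"
      by (rule G.spectral_radius_rayleigh(1)[OF neG])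
    also have "(\<Sum>u\<in>pverts G. (g (\<psi> u))\<^sup>2) = 1"
      using g(1) by (simp add: sum.reindex_bij_betw[OF bij', where g = "\<lambda>v. (g v)\<^sup>2"])
    finally show ?thesis
      using g(2) by simp
  qed
  ultimately show ?thesis
    by auto
qed

end
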